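(* Let $\Gamma:\mathbb R^2\times\mathbb R^2\to\mathbb R^2$ be a symmetric bilinear map, let $\nabla$ be the symmetric connection on $\mathbb R^2$ given by $\nabla_XY=\mathrm dY(X)+\Gamma(X,Y)$ for smooth vector fields $X,Y$ on $\mathbb R^2$, and let $\mathcal S\subset\mathrm{Lin}(\mathbb R^2)$ be the range of the linear map $v\mapsto\Gamma(v,\cdot)$. Then there exists a semi-Riemannian metric $g$ on $\mathbb R^2$ having $\nabla$ as its Levi-Civita connection if and only if $[X,Y]=0$ for all $X,Y\in\mathcal S$. In this case, a semi-Riemannian metric $g$ on $\mathbb R^2$ having $\nabla$ as its Levi-Civita connection can be chosen with an arbitrary value $g_0$ at the origin, where $g_0$ is any nondegenerate symmetric bilinear form on $T_0\mathbb R^2\cong\mathbb R^2$.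
   Context: $\mathrm{Lin}(\mathbb R^2)$ is the space of linear endomorphisms of $\mathbb R^2$, with $[X,Y]=XY-YX$. A semi-Riemannian metric is a smooth, globally defined, symmetric bilinear form field on the tangent spaces that is nondegenerate at each point (no definiteness required). A symmetric (torsion-free) connection $\nabla$ is the Levi-Civita connection of $g$ when $\nabla g=0$. *)

theory Defs
  imports "HOL-Analysis.Analysis"
begin

text \<open>
  Everything lives on a Euclidean space \<open>'a\<close> with its global chart: every tangent space is
  identified with \<open>'a\<close>, so a vector field is a function \<open>'a \<Rightarrow> 'a\<close> and a field of bilinear forms
  is a function \<open>'a \<Rightarrow> 'a \<Rightarrow> 'a \<Rightarrow> real\<close> whose first argument is the base point.
\<close>

subsection \<open>Smooth functions\<close>

primrec C_diff :: "nat \<Rightarrow> ('a::euclidean_space \<Rightarrow> 'b::real_normed_vector) \<Rightarrow> bool" where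
  "C_diff 0 f \<longleftrightarrow> continuous_on UNIV f"
| "C_diff (Suc k) f \<longleftrightarrow> f differentiable_on UNIV \<and>
     (\<forall>v. C_diff k (\<lambda>x. frechet_derivative f (at x) v))"

definition smooth :: "('a::euclidean_space \<Rightarrow> 'b::real_normed_vector) \<Rightarrow> bool" where
  "smooth f \<longleftrightarrow> (\<forall>k. C_diff k f)"

subsection \<open>Connections\<close>

text \<open>The derivative of \<open>F\<close> along the vector field \<open>X\<close>, i.e. \<open>p \<mapsto> dF\<^sub>p(X\<^sub>p)\<close>.\<close>

definition dir_deriv ::
    "('a::euclidean_space \<Rightarrow> 'a) \<Rightarrow> ('a \<Rightarrow> 'b::real_normed_vector) \<Rightarrow> 'a \<Rightarrow> 'b" where
  "dir_deriv X F p = frechet_derivative F (at p) (X p)"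

definition vf_bracket :: "('a::euclidean_space \<Rightarrow> 'a) \<Rightarrow> ('a \<Rightarrow> 'a) \<Rightarrow> 'a \<Rightarrow> 'a" where
  "vf_bracket X Y p = dir_deriv X Y p - dir_deriv Y X p"

text \<open>
  A connection \<open>D\<close> is an operator on smooth vector fields, with \<open>D X Y\<close> standing for the
  covariant derivative of \<open>Y\<close> along \<open>X\<close>; its values on non-smooth arguments are irrelevant.
\<close>

definition affine_connection ::
    "(('a::euclidean_space \<Rightarrow> 'a) \<Rightarrow> ('a \<Rightarrow> 'a) \<Rightarrow> 'a \<Rightarrow> 'a) \<Rightarrow> bool" where
  "affine_connection D \<longleftrightarrow>
     (\<forall>X Y. smooth X \<longrightarrow> smooth Y \<longrightarrow> smooth (D X Y)) \<and>
     (\<forall>X X' Y. smooth X \<longrightarrow> smooth X' \<longrightarrow> smooth Y \<longrightarrow>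
        D (\<lambda>p. X p + X' p) Y = (\<lambda>p. D X Y p + D X' Y p)) \<and>
     (\<forall>(f :: 'a \<Rightarrow> real) X Y. smooth f \<longrightarrow> smooth X \<longrightarrow> smooth Y \<longrightarrow>
        D (\<lambda>p. f p *\<^sub>R X p) Y = (\<lambda>p. f p *\<^sub>R D X Y p)) \<and>
     (\<forall>X Y Y'. smooth X \<longrightarrow> smooth Y \<longrightarrow> smooth Y' \<longrightarrow>
        D X (\<lambda>p. Y p + Y' p) = (\<lambda>p. D X Y p + D X Y' p)) \<and>
     (\<forall>(f :: 'a \<Rightarrow> real) X Y. smooth f \<longrightarrow> smooth X \<longrightarrow> smooth Y \<longrightarrow>
        D X (\<lambda>p. f p *\<^sub>R Y p) = (\<lambda>p. dir_deriv X f p *\<^sub>R Y p + f p *\<^sub>R D X Y p))"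

definition torsion_free ::
    "(('a::euclidean_space \<Rightarrow> 'a) \<Rightarrow> ('a \<Rightarrow> 'a) \<Rightarrow> 'a \<Rightarrow> 'a) \<Rightarrow> bool" where
  "torsion_free D \<longleftrightarrow>
     (\<forall>X Y. smooth X \<longrightarrow> smooth Y \<longrightarrow> (\<forall>p. D X Y p - D Y X p = vf_bracket X Y p))"

text \<open>The connection with constant Christoffel map \<open>\<Gamma>\<close> in the standard chart.\<close>

definition const_connection ::
    "('a::euclidean_space \<Rightarrow> 'a \<Rightarrow> 'a) \<Rightarrow> ('a \<Rightarrow> 'a) \<Rightarrow> ('a \<Rightarrow> 'a) \<Rightarrow> 'a \<Rightarrow> 'a" where
  "const_connection \<Gamma> X Y p = dir_deriv X Y p + \<Gamma> (X p) (Y p)"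

subsection \<open>Semi-Riemannian metrics\<close>

definition nondegenerate_symmetric_form :: "('a::real_vector \<Rightarrow> 'a \<Rightarrow> real) \<Rightarrow> bool" where
  "nondegenerate_symmetric_form b \<longleftrightarrow>
     bilinear b \<and> (\<forall>u v. b u v = b v u) \<and> (\<forall>u. (\<forall>v. b u v = 0) \<longrightarrow> u = 0)"

definition semi_riemannian_metric ::
    "('a::euclidean_space \<Rightarrow> 'a \<Rightarrow> 'a \<Rightarrow> real) \<Rightarrow> bool" where
  "semi_riemannian_metric g \<longleftrightarrow>
     (\<forall>p. nondegenerate_symmetric_form (g p)) \<and> (\<forall>u v. smooth (\<lambda>p. g p u v))"

text \<open>The covariant derivative \<open>(D\<^sub>Z g)(X, Y)\<close>.\<close>

definition cov_deriv_form ::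
    "(('a::euclidean_space \<Rightarrow> 'a) \<Rightarrow> ('a \<Rightarrow> 'a) \<Rightarrow> 'a \<Rightarrow> 'a) \<Rightarrow> ('a \<Rightarrow> 'a \<Rightarrow> 'a \<Rightarrow> real) \<Rightarrow>
     ('a \<Rightarrow> 'a) \<Rightarrow> ('a \<Rightarrow> 'a) \<Rightarrow> ('a \<Rightarrow> 'a) \<Rightarrow> 'a \<Rightarrow> real" where
  "cov_deriv_form D g Z X Y p =
     dir_deriv Z (\<lambda>q. g q (X q) (Y q)) p - g p (D Z X p) (Y p) - g p (X p) (D Z Y p)"

definition levi_civita_connection ::
    "(('a::euclidean_space \<Rightarrow> 'a) \<Rightarrow> ('a \<Rightarrow> 'a) \<Rightarrow> 'a \<Rightarrow> 'a) \<Rightarrow> ('a \<Rightarrow> 'a \<Rightarrow> 'a \<Rightarrow> real) \<Rightarrow> bool" where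
  "levi_civita_connection D g \<longleftrightarrow>
     affine_connection D \<and> torsion_free D \<and>
     (\<forall>X Y Z. smooth X \<longrightarrow> smooth Y \<longrightarrow> smooth Z \<longrightarrow> (\<forall>p. cov_deriv_form D g Z X Y p = 0))"

subsection \<open>Commutators of endomorphisms\<close>

definition commutator :: "('a::real_vector \<Rightarrow> 'a) \<Rightarrow> ('a \<Rightarrow> 'a) \<Rightarrow> 'a \<Rightarrow> 'a" where
  "commutator A B = (\<lambda>v. A (B v) - B (A v))"

end

theory Submission
  imports Defs
begin

text \<open>
  For constant vector fields the equation \<open>\<nabla>g = 0\<close> reads
  \<open>d(g(u, v))(w) = g(\<Gamma>\<^sub>w u, v) + g(u, \<Gamma>\<^sub>w v)\<close>, where \<open>\<Gamma>\<^sub>w = \<Gamma>(w, \<cdot>)\<close>: a linear system of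
  differential equations with constant coefficients for the entries of \<open>g\<close>.

  If the \<open>\<Gamma>\<^sub>w\<close> commute, the system is integrated by the exponential: since \<open>p \<mapsto> \<Gamma>\<^sub>p\<close> is linear with
  commuting values, \<open>E\<^sub>p = exp \<Gamma>\<^sub>p\<close> has differential \<open>w \<mapsto> E\<^sub>p \<circ> \<Gamma>\<^sub>w\<close>, so that
  \<open>g\<^sub>p(u, v) = g\<^sub>0(E\<^sub>p u, E\<^sub>p v)\<close> solves it, and it is nondegenerate because each \<open>E\<^sub>p\<close> is invertible. This
  works in every dimension (\<open>exists_metric_if_commuting\<close>).

  Conversely, the symmetry of the second derivatives of \<open>g(u, v)\<close> forces every commutator
  \<open>R = [\<Gamma>\<^sub>w, \<Gamma>\<^sub>z]\<close> to be skew-adjoint with respect to \<open>g\<^sub>p\<close>, at all points \<open>p\<close> (\<open>curvature_skew\<close>). As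
  \<open>R\<close> does not depend on \<open>p\<close>, this identity can be differentiated, which shows that \<open>S = [\<Gamma>\<^sub>w, R]\<close> is
  skew-adjoint too (\<open>commutator_skew\<close>). In the plane the skew-adjoint maps form a line and all of them but
  \<open>0\<close> are invertible (\<open>skew_plane\<close>). Hence, if \<open>R \<noteq> 0\<close>, then \<open>[\<Gamma>\<^sub>w, R] = c R\<close> with \<open>R\<close> an invertible
  commutator of \<open>\<Gamma>\<^sub>w\<close>; comparing traces shows that this is impossible
  (\<open>det_commutator_eigen_eq_0\<close>).
\<close>

section \<open>Smooth maps\<close>

text \<open>
  The recursion in the definition of \<open>C_diff\<close> goes through \<open>frechet_derivative\<close>, a choice operator.
  With this rule an explicit formula for the derivative can be used in its place.
\<close>

lemma C_diff_SucI:
  assumes "\<And>x. (f has_derivative f' x) (at x)" and "\<And>v. C_diff k (\<lambda>x. f' x v)"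
  shows "C_diff (Suc k) f"
proof -
  have "f' x = frechet_derivative f (at x)" for x
    by (rule frechet_derivative_at) (rule assms)
  then show ?thesis
    using assms by (auto simp: differentiable_on_def differentiable_def)
qed

lemma C_diff_Suc_has_derivative:
  assumes "C_diff (Suc k) f"
  shows "(f has_derivative frechet_derivative f (at x)) (at x)"
  using assms by (simp add: differentiable_on_def frechet_derivative_works)

lemma C_diff_SucD: "C_diff (Suc k) f \<Longrightarrow> C_diff k f"
proof (induction k arbitrary: f)
  case 0
  then show ?case by (simp add: differentiable_imp_continuous_on)
next
  case (Suc k)
  then show ?case by (metis C_diff.simps(2))
qed

lemma C_diff_const: "C_diff k (\<lambda>_. c)"
  by (induction k arbitrary: c) auto

lemma C_diff_add:
  "C_diff k f \<Longrightarrow> C_diff k g \<Longrightarrow> C_diff k (\<lambda>x. f x + g x)"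
proof (induction k arbitrary: f g)
  case 0
  then show ?case by (simp add: continuous_on_add)
next
  case (Suc k)
  show ?case
  proof (rule C_diff_SucI)
    show "((\<lambda>x. f x + g x) has_derivative
        (\<lambda>v. frechet_derivative f (at x) v + frechet_derivative g (at x) v)) (at x)" for x
      using Suc.prems by (intro has_derivative_add C_diff_Suc_has_derivative)
    show "C_diff k (\<lambda>x. frechet_derivative f (at x) v + frechet_derivative g (at x) v)" for v
      using Suc by auto
  qed
qed

text \<open>
  The product rule expresses the derivative through products of the same kind, so the
  induction has to run over all pairs of factors at once.
\<close>

lemma C_diff_bounded_bilinear:
  assumes "bounded_bilinear B"
  shows "C_diff k f \<Longrightarrow> C_diff k g \<Longrightarrow> C_diff k (\<lambda>x. B (f x) (g x))"
proof (induction k arbitrary: f g)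
  case 0
  then show ?case by (simp add: bounded_bilinear.continuous_on[OF assms])
next
  case (Suc k)
  show ?case
  proof (rule C_diff_SucI)
    show "((\<lambda>x. B (f x) (g x)) has_derivative
        (\<lambda>v. B (f x) (frechet_derivative g (at x) v) + B (frechet_derivative f (at x) v) (g x)))
        (at x)" for x
      using Suc.prems by (intro bounded_bilinear.FDERIV[OF assms] C_diff_Suc_has_derivative)
    show "C_diff k (\<lambda>x. B (f x) (frechet_derivative g (at x) v)
        + B (frechet_derivative f (at x) v) (g x))" for v
      using Suc.prems by (intro C_diff_add Suc.IH) (auto dest: C_diff_SucD simp del: C_diff.simps, auto)
  qed
qed

lemma C_diff_bounded_linear:
  assumes "bounded_linear L"
  shows "C_diff k f \<Longrightarrow> C_diff k (\<lambda>x. L (f x))"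
proof (induction k arbitrary: f)
  case 0
  then show ?case by (simp add: bounded_linear.continuous_on[OF assms])
next
  case (Suc k)
  show ?case
  proof (rule C_diff_SucI)
    show "((\<lambda>x. L (f x)) has_derivative (\<lambda>v. L (frechet_derivative f (at x) v))) (at x)" for x
      using Suc.prems by (intro bounded_linear.has_derivative[OF assms] C_diff_Suc_has_derivative)
    show "C_diff k (\<lambda>x. L (frechet_derivative f (at x) v))" for v
      using Suc.prems by (intro Suc.IH) auto
  qed
qed

lemma smooth_const: "smooth (\<lambda>_. c)"
  by (simp add: smooth_def C_diff_const)

lemma smooth_add: "smooth f \<Longrightarrow> smooth g \<Longrightarrow> smooth (\<lambda>x. f x + g x)"
  by (simp add: smooth_def C_diff_add)

lemma smooth_sum: "(\<And>i. i \<in> I \<Longrightarrow> smooth (f i)) \<Longrightarrow> smooth (\<lambda>x. \<Sum>i\<in>I. f i x)"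
  by (induction I rule: infinite_finite_induct) (auto intro: smooth_const smooth_add)

lemma smooth_bounded_bilinear:
  "bounded_bilinear B \<Longrightarrow> smooth f \<Longrightarrow> smooth g \<Longrightarrow> smooth (\<lambda>x. B (f x) (g x))"
  by (simp add: smooth_def C_diff_bounded_bilinear)

lemma smooth_bounded_linear:
  "bounded_linear L \<Longrightarrow> smooth f \<Longrightarrow> smooth (\<lambda>x. L (f x))"
  by (simp add: smooth_def C_diff_bounded_linear)

lemma smooth_frechet_derivative: "smooth f \<Longrightarrow> smooth (\<lambda>x. frechet_derivative f (at x) v)"
  unfolding smooth_def by (metis C_diff.simps(2))

lemma smooth_has_derivative:
  "smooth f \<Longrightarrow> (f has_derivative frechet_derivative f (at x)) (at x)"
  unfolding smooth_def using C_diff_Suc_has_derivative by blast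

lemma smooth_isCont: "smooth f \<Longrightarrow> isCont f x"
  using has_derivative_continuous smooth_has_derivative by blast

lemma dir_deriv_eq: "(F has_derivative F') (at p) \<Longrightarrow> dir_deriv X F p = F' (X p)"
  by (metis dir_deriv_def frechet_derivative_at)

text \<open>
  \<open>C_diff\<close> controls the derivative in fixed directions only; a variable direction \<open>X p\<close> is
  reduced to these by expanding it in the standard basis.
\<close>

lemma smooth_dir_deriv:
  assumes "smooth X" "smooth F"
  shows "smooth (dir_deriv X F)"
proof -
  have "dir_deriv X F = (\<lambda>p. \<Sum>b\<in>Basis. (X p \<bullet> b) *\<^sub>R frechet_derivative F (at p) b)"
  proof
    fix p
    have lin: "linear (frechet_derivative F (at p))"
      using smooth_has_derivative[OF assms(2)] has_derivative_linear by blast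
    have "dir_deriv X F p = frechet_derivative F (at p) (\<Sum>b\<in>Basis. (X p \<bullet> b) *\<^sub>R b)"
      by (simp add: dir_deriv_def euclidean_representation)
    also have "\<dots> = (\<Sum>b\<in>Basis. (X p \<bullet> b) *\<^sub>R frechet_derivative F (at p) b)"
      using lin by (simp add: linear_sum linear_scale)
    finally show "dir_deriv X F p = (\<Sum>b\<in>Basis. (X p \<bullet> b) *\<^sub>R frechet_derivative F (at p) b)" .
  qed
  moreover have "smooth (\<lambda>p. X p \<bullet> b)" for b
    by (rule smooth_bounded_linear[OF bounded_linear_inner_left assms(1)])
  ultimately show ?thesis
    using assms(2)
    by (auto intro!: smooth_sum smooth_bounded_bilinear[OF bounded_bilinear_scaleR]
        smooth_frechet_derivative)
qed

text \<open>
  The second difference of \<open>f\<close> over the parallelogram spanned by \<open>h v\<close> and \<open>h w\<close> is symmetric in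
  \<open>v\<close> and \<open>w\<close>. By the mean value theorem, taken in either order, it is \<open>h\<^sup>2\<close> times a mixed second
  derivative at a nearby point; divide by \<open>h\<^sup>2\<close> and let \<open>h\<close> tend to \<open>0\<close>.
\<close>

lemma symmetric_second_derivative:
  fixes f :: "'a::euclidean_space \<Rightarrow> real"
  assumes f: "smooth f"
  shows "frechet_derivative (\<lambda>x. frechet_derivative f (at x) v) (at p) w
       = frechet_derivative (\<lambda>x. frechet_derivative f (at x) w) (at p) v"
proof -
  define D where "D F a = (\<lambda>x. frechet_derivative F (at x) a)" for F :: "'a \<Rightarrow> real" and a
  have line: "((\<lambda>s. F (q + s *\<^sub>R a)) has_real_derivative D F a (q + s *\<^sub>R a)) (at s)"
    if "smooth F" for F q a s
  proof -
    have lin: "linear (frechet_derivative F (at (q + s *\<^sub>R a)))"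
      using smooth_has_derivative[OF that] has_derivative_linear by blast
    have "((\<lambda>s. F (q + s *\<^sub>R a)) has_derivative
        (\<lambda>h. frechet_derivative F (at (q + s *\<^sub>R a)) (h *\<^sub>R a))) (at s)"
      by (rule has_derivative_compose[OF _ smooth_has_derivative[OF that]])
        (auto intro!: derivative_eq_intros)
    then show ?thesis
      by (simp add: has_field_derivative_def D_def linear_scale[OF lin] mult_commute_abs)
  qed
  have smooth_D: "smooth (D F a)" if "smooth F" for F a
    using smooth_frechet_derivative[OF that] by (simp add: D_def)
  define \<Delta> where "\<Delta> h = f (p + h *\<^sub>R v + h *\<^sub>R w) - f (p + h *\<^sub>R v) - (f (p + h *\<^sub>R w) - f p)" for h :: real
  \<comment> \<open>First along \<open>a\<close>, for the difference of \<open>f\<close> across the side \<open>h b\<close>; then along \<open>b\<close>.\<close>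
  have mvt: "\<exists>s t. 0 < s \<and> s < h \<and> 0 < t \<and> t < h \<and>
      f (p + h *\<^sub>R a + h *\<^sub>R b) - f (p + h *\<^sub>R a) - (f (p + h *\<^sub>R b) - f p)
        = h * h * D (D f a) b (p + s *\<^sub>R a + t *\<^sub>R b)" if "h > 0" for h a b
  proof -
    define \<phi> where "\<phi> s = f ((p + h *\<^sub>R b) + s *\<^sub>R a) - f (p + s *\<^sub>R a)" for s
    have "(\<phi> has_real_derivative D f a ((p + h *\<^sub>R b) + s *\<^sub>R a) - D f a (p + s *\<^sub>R a)) (at s)" for s
      unfolding \<phi>_def by (intro DERIV_diff line f)
    from MVT2[OF \<open>h > 0\<close> this] obtain s where s: "0 < s" "s < h"
      "\<phi> h - \<phi> 0 = (h - 0) * (D f a ((p + h *\<^sub>R b) + s *\<^sub>R a) - D f a (p + s *\<^sub>R a))" by metis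
    from MVT2[OF \<open>h > 0\<close> line[OF smooth_D[OF f, of a], where q = "p + s *\<^sub>R a" and a = b]]
    obtain t where t: "0 < t" "t < h"
      "D f a (p + s *\<^sub>R a + h *\<^sub>R b) - D f a (p + s *\<^sub>R a)
        = h * D (D f a) b (p + s *\<^sub>R a + t *\<^sub>R b)" by auto
    show ?thesis
      using s t by (intro exI[of _ s] exI[of _ t]) (auto simp: \<phi>_def algebra_simps)
  qed
  have lim: "((\<lambda>h. \<Delta> h / (h * h)) \<longlongrightarrow> D (D f a) b p) (at_right 0)"
    if ab: "(a = v \<and> b = w) \<or> (a = w \<and> b = v)" for a b
  proof -
    have "\<exists>s t. 0 < s \<and> s < h \<and> 0 < t \<and> t < h \<and>
        \<Delta> h = h * h * D (D f a) b (p + s *\<^sub>R a + t *\<^sub>R b)" if "h > 0" for h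
    proof -
      have "\<Delta> h = f (p + h *\<^sub>R a + h *\<^sub>R b) - f (p + h *\<^sub>R a) - (f (p + h *\<^sub>R b) - f p)"
        using ab by (auto simp: \<Delta>_def algebra_simps)
      then show ?thesis
        using mvt[OF that, of a b] by simp
    qed
    then obtain s t where st: "\<And>h. h > 0 \<Longrightarrow> 0 < s h \<and> s h < h \<and> 0 < t h \<and> t h < h \<and>
        \<Delta> h = h * h * D (D f a) b (p + s h *\<^sub>R a + t h *\<^sub>R b)" by metis
    have pos: "eventually (\<lambda>h::real. 0 < h) (at_right 0)"
      by (simp add: eventually_at_right_less)
    have s0: "(s \<longlongrightarrow> 0) (at_right 0)"
      by (rule tendsto_sandwich[of "\<lambda>_. 0" _ _ "\<lambda>h. h"])
        (auto intro!: eventually_mono[OF pos] tendsto_ident_at dest: st)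
    have t0: "(t \<longlongrightarrow> 0) (at_right 0)"
      by (rule tendsto_sandwich[of "\<lambda>_. 0" _ _ "\<lambda>h. h"])
        (auto intro!: eventually_mono[OF pos] tendsto_ident_at dest: st)
    have "((\<lambda>h. p + s h *\<^sub>R a + t h *\<^sub>R b) \<longlongrightarrow> p + 0 *\<^sub>R a + 0 *\<^sub>R b) (at_right 0)"
      by (intro tendsto_intros s0 t0)
    then have "((\<lambda>h. D (D f a) b (p + s h *\<^sub>R a + t h *\<^sub>R b)) \<longlongrightarrow> D (D f a) b p) (at_right 0)"
      using isCont_tendsto_compose[OF smooth_isCont[OF smooth_D[OF smooth_D[OF f]]]] by fastforce
    moreover have "eventually (\<lambda>h. D (D f a) b (p + s h *\<^sub>R a + t h *\<^sub>R b) = \<Delta> h / (h * h)) (at_right 0)"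
      by (rule eventually_mono[OF pos]) (use st in force)
    ultimately show ?thesis
      by (rule Lim_transform_eventually)
  qed
  have "D (D f v) w p = D (D f w) v p"
    by (rule tendsto_unique[OF _ lim lim]) auto
  then show ?thesis
    by (simp add: D_def)
qed

section \<open>The Banach algebra of endomorphisms\<close>

text \<open>
  The exponential function is defined on Banach algebras as a type class. Bounded linear maps from
  a space to itself are a special case of a two-parameter type, which cannot carry that class, so they
  get a type of their own; all structure is that of \<open>'a \<Rightarrow>\<^sub>L 'a\<close>, with composition as product.
  Perfect spaces are nontrivial, which gives the identity norm \<open>1\<close>.
\<close>

typedef (overloaded) 'a endo = "UNIV :: ('a::{banach,perfect_space} \<Rightarrow>\<^sub>L 'a) set"
  morphisms blinfun_of_endo endo_of_blinfun by simp

setup_lifting type_definition_endo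

instantiation endo :: ("{banach,perfect_space}") real_normed_algebra_1
begin

lift_definition zero_endo :: "'a endo" is 0 .
lift_definition one_endo :: "'a endo" is id_blinfun .
lift_definition plus_endo :: "'a endo \<Rightarrow> 'a endo \<Rightarrow> 'a endo" is "(+)" .
lift_definition minus_endo :: "'a endo \<Rightarrow> 'a endo \<Rightarrow> 'a endo" is "(-)" .
lift_definition uminus_endo :: "'a endo \<Rightarrow> 'a endo" is uminus .
lift_definition times_endo :: "'a endo \<Rightarrow> 'a endo \<Rightarrow> 'a endo" is "(o\<^sub>L)" .
lift_definition scaleR_endo :: "real \<Rightarrow> 'a endo \<Rightarrow> 'a endo" is scaleR .
lift_definition norm_endo :: "'a endo \<Rightarrow> real" is norm .

definition dist_endo :: "'a endo \<Rightarrow> 'a endo \<Rightarrow> real"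
  where "dist_endo a b = norm (a - b)"

definition sgn_endo :: "'a endo \<Rightarrow> 'a endo"
  where "sgn_endo a = inverse (norm a) *\<^sub>R a"

definition uniformity_endo :: "('a endo \<times> 'a endo) filter"
  where "uniformity_endo = (INF e\<in>{0 <..}. principal {(x, y). dist x y < e})"

definition open_endo :: "'a endo set \<Rightarrow> bool"
  where "open_endo S \<longleftrightarrow> (\<forall>x\<in>S. \<forall>\<^sub>F (x', y) in uniformity. x' = x \<longrightarrow> y \<in> S)"

instance
proof
  fix a b c :: "'a endo" and r s :: real
  show "(a * b) * c = a * (b * c)"
    by transfer (auto intro!: blinfun_eqI)
  show "1 * a = a" "a * 1 = a"
    by (transfer; auto intro!: blinfun_eqI)+
  show "(a + b) * c = a * c + b * c" "a * (b + c) = a * b + a * c"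
    "(r *\<^sub>R a) * b = r *\<^sub>R (a * b)" "a * (r *\<^sub>R b) = r *\<^sub>R (a * b)"
    by (transfer; auto intro!: blinfun_eqI simp: blinfun.bilinear_simps)+
  show "(0 :: 'a endo) \<noteq> 1"
    by transfer (metis norm_blinfun_id norm_zero zero_neq_one)
  show "norm (a * b) \<le> norm a * norm b"
    by transfer (rule norm_blinfun_compose)
  show "norm (1 :: 'a endo) = 1"
    by transfer simp
  show "norm (a + b) \<le> norm a + norm b"
    by transfer (rule norm_triangle_ineq)
qed (transfer; simp add: dist_endo_def sgn_endo_def uniformity_endo_def open_endo_def algebra_simps;
     fail | simp add: dist_endo_def sgn_endo_def uniformity_endo_def open_endo_def)+

end

instance endo :: ("{banach,perfect_space}") banach
proof
  fix X :: "nat \<Rightarrow> 'a endo"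
  have isometry: "dist (blinfun_of_endo a) (blinfun_of_endo b) = dist a b" for a b :: "'a endo"
    by (simp add: dist_norm norm_endo.rep_eq minus_endo.rep_eq)
  assume "Cauchy X"
  then have "Cauchy (\<lambda>n. blinfun_of_endo (X n))"
    by (simp add: Cauchy_def isometry)
  then obtain L where L: "(\<lambda>n. blinfun_of_endo (X n)) \<longlonglongrightarrow> L"
    using Cauchy_convergent convergent_def by blast
  have "X \<longlonglongrightarrow> endo_of_blinfun L"
    using L by (simp add: lim_sequentially isometry[symmetric] endo_of_blinfun_inverse)
  then show "convergent X"
    by (auto simp: convergent_def)
qed

lift_definition endo_apply :: "'a::{banach,perfect_space} endo \<Rightarrow> 'a \<Rightarrow> 'a" is blinfun_apply .

lift_definition endo_of :: "('a::euclidean_space \<Rightarrow> 'a) \<Rightarrow> 'a endo" is Blinfun .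

lemma endo_apply_mult [simp]: "endo_apply (a * b) v = endo_apply a (endo_apply b v)"
  by transfer simp

lemma endo_apply_one [simp]: "endo_apply 1 v = v"
  by transfer simp

lemma endo_apply_endo_of: "linear f \<Longrightarrow> endo_apply (endo_of f) = f"
  by transfer (simp add: bounded_linear_Blinfun_apply linear_conv_bounded_linear)

lemma endo_eqI: "(\<And>v. endo_apply a v = endo_apply b v) \<Longrightarrow> a = b"
  by transfer (rule blinfun_eqI)

lemma bounded_bilinear_endo_apply: "bounded_bilinear endo_apply"
proof
  show "\<exists>K. \<forall>a b. norm (endo_apply a b) \<le> norm a * norm b * K"
    by (intro exI[of _ 1]) (simp add: endo_apply.rep_eq norm_endo.rep_eq norm_blinfun)
qed (transfer; simp add: blinfun.bilinear_simps)+

section \<open>The exponential of a commuting linear family\<close>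

text \<open>
  The series of \<open>exp x - 1 - x\<close> is dominated term by term by the one for the real number
  \<open>norm x\<close>, for which the estimate is known.
\<close>

lemma norm_exp_minus_linear_part:
  fixes x :: "'a::{real_normed_algebra_1,banach}"
  assumes "norm x \<le> 1"
  shows "norm (exp x - 1 - x) \<le> (norm x)\<^sup>2"
proof -
  have summable: "summable (\<lambda>n. inverse (fact (n + 2)) *\<^sub>R norm x ^ (n + 2))"
    by (rule summable_ignore_initial_segment[OF summable_exp_generic])
  have le: "norm (inverse (fact (n + 2)) *\<^sub>R x ^ (n + 2)) \<le> inverse (fact (n + 2)) *\<^sub>R norm x ^ (n + 2)" for n
    using norm_power_ineq[of x "n + 2"] by (simp del: power_Suc)
  have "exp x - 1 - x = (\<Sum>n. inverse (fact (n + 2)) *\<^sub>R x ^ (n + 2))"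
    using exp_first_two_terms[of x] by (simp add: algebra_simps)
  also have "norm \<dots> \<le> (\<Sum>n. inverse (fact (n + 2)) *\<^sub>R norm x ^ (n + 2))"
    by (rule norm_suminf_le[OF le summable])
  also have "\<dots> = exp (norm x) - 1 - norm x"
    using exp_first_two_terms[of "norm x"] by simp
  also have "\<dots> \<le> (norm x)\<^sup>2"
    using exp_bound[OF norm_ge_zero assms] by simp
  finally show ?thesis .
qed

lemma exp_has_derivative_at_0:
  "((exp :: 'a::{real_normed_algebra_1,banach} \<Rightarrow> 'a) has_derivative (\<lambda>h. h)) (at 0)"
proof -
  have "((\<lambda>x. norm (exp x - 1 - x) / norm x) \<longlongrightarrow> 0) (at (0::'a))"
  proof (rule tendsto_sandwich[where f = "\<lambda>_. 0" and h = norm])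
    have "eventually (\<lambda>x::'a. norm x \<le> 1) (at 0)"
      by (auto simp: eventually_at intro!: exI[of _ 1])
    then show "eventually (\<lambda>x::'a. norm (exp x - 1 - x) / norm x \<le> norm x) (at 0)"
    proof eventually_elim
      case (elim x)
      show ?case
        using norm_exp_minus_linear_part[OF elim]
        by (cases "x = 0") (auto simp: divide_le_eq power2_eq_square)
    qed
    show "(norm \<longlongrightarrow> 0) (at (0::'a))"
      by (rule tendsto_norm_zero) (rule tendsto_ident_at)
  qed auto
  then show ?thesis
    by (simp add: has_derivative_iff_norm)
qed

text \<open>
  In a noncommutative algebra the exponential has no simple derivative. Along a commuting family,
  however, \<open>exp (f q) = exp (f p) * exp (f (q - p))\<close>, which transports the derivative at \<open>0\<close> to \<open>p\<close>.
\<close>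

lemma exp_commuting_has_derivative:
  fixes f :: "'a::real_normed_vector \<Rightarrow> 'b::{real_normed_algebra_1,banach}"
  assumes f: "bounded_linear f" and comm: "\<And>x y. f x * f y = f y * f x"
  shows "((\<lambda>p. exp (f p)) has_derivative (\<lambda>h. exp (f p) * f h)) (at p)"
proof -
  interpret bounded_linear f by (rule f)
  have f0: "((\<lambda>q. f (q - p)) has_derivative f) (at p)"
    by (auto intro!: derivative_eq_intros bounded_linear.has_derivative[OF f])
  have "((\<lambda>q. exp (f (q - p))) has_derivative f) (at p)"
    using has_derivative_compose[OF f0, of exp "\<lambda>h. h"] exp_has_derivative_at_0 by (simp add: zero)
  then have "((\<lambda>q. exp (f p) * exp (f (q - p))) has_derivative (\<lambda>h. exp (f p) * f h)) (at p)"
    by (rule has_derivative_mult_right)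
  moreover have "exp (f p) * exp (f (q - p)) = exp (f q)" for q
    using exp_add_commuting[OF comm, of p "q - p"] by (simp flip: add)
  ultimately show ?thesis
    by simp
qed

section \<open>The Levi-Civita condition for a constant connection\<close>

lemma affine_connection_const_connection:
  fixes \<Gamma> :: "'a::euclidean_space \<Rightarrow> 'a \<Rightarrow> 'a"
  assumes "bilinear \<Gamma>"
  shows "affine_connection (const_connection \<Gamma>)"
proof -
  have bb: "bounded_bilinear \<Gamma>"
    using assms by (simp add: bilinear_conv_bounded_bilinear)
  interpret bounded_bilinear \<Gamma> by (rule bb)
  have lin: "linear (frechet_derivative F (at p))" if "smooth F" for F :: "'a \<Rightarrow> 'a" and p
    using smooth_has_derivative[OF that] has_derivative_linear by blast
  have "smooth (const_connection \<Gamma> X Y)" if "smooth X" "smooth Y" for X Y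
    using smooth_add[OF smooth_dir_deriv[OF that] smooth_bounded_bilinear[OF bb that]]
    by (simp add: const_connection_def[abs_def])
  moreover have "dir_deriv X (\<lambda>p. Y p + Y' p) p = dir_deriv X Y p + dir_deriv X Y' p"
    if "smooth Y" "smooth Y'" for X Y Y' :: "'a \<Rightarrow> 'a" and p
    using that by (subst dir_deriv_eq[OF has_derivative_add])
      (auto intro: smooth_has_derivative simp: dir_deriv_def)
  moreover have "dir_deriv X (\<lambda>p. f p *\<^sub>R Y p) p = dir_deriv X f p *\<^sub>R Y p + f p *\<^sub>R dir_deriv X Y p"
    if "smooth f" "smooth Y" for f :: "'a \<Rightarrow> real" and X Y :: "'a \<Rightarrow> 'a" and p
    using that by (subst dir_deriv_eq[OF has_derivative_scaleR])
      (auto intro: smooth_has_derivative simp: dir_deriv_def)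
  ultimately show ?thesis
    unfolding affine_connection_def const_connection_def[abs_def]
    by (auto simp: fun_eq_iff add_left add_right scaleR_left scaleR_right dir_deriv_def algebra_simps
        linear_add[OF lin] linear_scale[OF lin])
qed

lemma torsion_free_const_connection:
  assumes "\<And>u v. \<Gamma> u v = \<Gamma> v u"
  shows "torsion_free (const_connection \<Gamma>)"
  using assms by (simp add: torsion_free_def const_connection_def vf_bracket_def)

text \<open>
  On constant fields the covariant derivative is \<open>\<Gamma>\<close> itself, and \<open>\<nabla>g = 0\<close> becomes a first-order linear
  system for \<open>g\<close>. This is all that the necessity of the commutation relations uses.
\<close>

lemma levi_civita_const_connection_derivative:
  fixes \<Gamma> :: "'a::euclidean_space \<Rightarrow> 'a \<Rightarrow> 'a"
  assumes g: "semi_riemannian_metric g" and lc: "levi_civita_connection (const_connection \<Gamma>) g"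
  shows "((\<lambda>q. g q u v) has_derivative (\<lambda>w. g p (\<Gamma> w u) v + g p u (\<Gamma> w v))) (at p)"
proof -
  have "frechet_derivative (\<lambda>q. g q u v) (at p) w = g p (\<Gamma> w u) v + g p u (\<Gamma> w v)" for w
  proof -
    have "cov_deriv_form (const_connection \<Gamma>) g (\<lambda>_. w) (\<lambda>_. u) (\<lambda>_. v) p = 0"
      using lc smooth_const unfolding levi_civita_connection_def by blast
    then show ?thesis
      by (simp add: cov_deriv_form_def const_connection_def dir_deriv_def)
  qed
  moreover have "smooth (\<lambda>q. g q u v)"
    using g by (simp add: semi_riemannian_metric_def)
  ultimately show ?thesis
    using smooth_has_derivative[of "\<lambda>q. g q u v" p] by presburger
qed

section \<open>Metrics from commuting Christoffel maps\<close>

text \<open>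
  The metric is \<open>b\<close> pulled back by \<open>E\<^sub>p = exp \<Gamma>\<^sub>p\<close>. The derivative of \<open>q \<mapsto> E\<^sub>q V\<^sub>q\<close> along \<open>Z\<close> is
  \<open>E (dV(Z) + \<Gamma>(Z, V)) = E (\<nabla>\<^sub>Z V)\<close>, so that \<open>\<nabla>g = 0\<close> is just the product rule for \<open>b\<close>.
\<close>

lemma exists_metric_if_commuting:
  fixes \<Gamma> :: "'a::euclidean_space \<Rightarrow> 'a \<Rightarrow> 'a"
  assumes \<Gamma>: "bilinear \<Gamma>" and sym: "\<And>u v. \<Gamma> u v = \<Gamma> v u"
    and comm: "\<And>u v w. \<Gamma> u (\<Gamma> v w) = \<Gamma> v (\<Gamma> u w)"
    and b: "nondegenerate_symmetric_form b"
  shows "\<exists>g. semi_riemannian_metric g \<and> levi_civita_connection (const_connection \<Gamma>) g \<and> g 0 = b"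
proof -
  have lin: "linear (\<Gamma> u)" for u
    using \<Gamma> by (simp add: bilinear_def)
  interpret \<Gamma>: bounded_bilinear \<Gamma>
    using \<Gamma> by (simp add: bilinear_conv_bounded_bilinear)
  have b_bb: "bounded_bilinear b" and b_sym: "b u v = b v u"
    and b_nondeg: "(\<And>v. b u v = 0) \<Longrightarrow> u = 0" for u v
    using b by (auto simp: nondegenerate_symmetric_form_def bilinear_conv_bounded_bilinear)
  interpret b: bounded_bilinear b by (rule b_bb)
  interpret ea: bounded_bilinear "endo_apply :: 'a endo \<Rightarrow> 'a \<Rightarrow> 'a"
    by (rule bounded_bilinear_endo_apply)
  define G where "G u = endo_of (\<Gamma> u)" for u
  have G_apply [simp]: "endo_apply (G u) v = \<Gamma> u v" for u v
    by (simp add: G_def endo_apply_endo_of lin)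
  have "linear G"
    by (rule linearI) (auto intro!: endo_eqI simp: ea.add_left ea.scaleR_left \<Gamma>.add_left \<Gamma>.scaleR_left)
  then have G_bl: "bounded_linear G"
    by (simp add: linear_conv_bounded_linear)
  have G_comm: "G u * G v = G v * G u" for u v
    by (rule endo_eqI) (simp add: comm)
  define E where "E p = exp (G p)" for p
  have E_deriv: "(E has_derivative (\<lambda>w. E p * G w)) (at p)" for p
    unfolding E_def[abs_def] by (rule exp_commuting_has_derivative[OF G_bl G_comm])
  have E0: "E 0 = 1"
    by (simp add: E_def linear_0[OF \<open>linear G\<close>])
  have E_smooth: "smooth E"
    unfolding smooth_def
  proof
    fix k
    show "C_diff k E"
    \<comment> \<open>The derivatives of \<open>E\<close> are linear images of \<open>E\<close> itself.\<close>
    proof (induction k)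
      case 0
      then show ?case
        using has_derivative_continuous[OF E_deriv] by (simp add: continuous_on_eq_continuous_at)
    next
      case (Suc k)
      show ?case
        by (rule C_diff_SucI[OF E_deriv])
          (rule C_diff_bounded_linear[OF bounded_linear_mult_left Suc])
    qed
  qed
  have E_inverse: "endo_apply (E p) (endo_apply (exp (- G p)) v) = v" for p v
    by (simp add: E_def exp_minus_inverse flip: endo_apply_mult)
  have E_inj: "u = 0" if "endo_apply (E p) u = 0" for p u
  proof -
    have "endo_apply (exp (- G p)) (endo_apply (E p) u) = u"
      using exp_minus_inverse[of "- G p"] by (simp add: E_def flip: endo_apply_mult)
    then show ?thesis
      using that by (simp add: ea.zero_right)
  qed
  define g where "g p u v = b (endo_apply (E p) u) (endo_apply (E p) v)" for p u v
  have "nondegenerate_symmetric_form (g p)" for p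
    unfolding nondegenerate_symmetric_form_def
  proof (intro conjI allI impI)
    show "bilinear (g p)"
      by (auto simp: bilinear_def g_def ea.add_right ea.scaleR_right b.add_left b.add_right
          b.scaleR_left b.scaleR_right intro!: linearI)
    show "g p u v = g p v u" for u v
      by (simp add: g_def b_sym)
    show "u = 0" if "\<forall>v. g p u v = 0" for u
    proof (rule E_inj, rule b_nondeg)
      fix v
      have "g p u (endo_apply (exp (- G p)) v) = 0"
        using that by blast
      then show "b (endo_apply (E p) u) v = 0"
        by (simp add: g_def E_inverse)
    qed
  qed
  moreover have "smooth (\<lambda>p. g p u v)" for u v
    unfolding g_def
    by (intro smooth_bounded_bilinear[OF b_bb] smooth_bounded_bilinear[OF bounded_bilinear_endo_apply]
        E_smooth smooth_const)
  ultimately have "semi_riemannian_metric g"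
    by (simp add: semi_riemannian_metric_def)
  moreover have "levi_civita_connection (const_connection \<Gamma>) g"
    unfolding levi_civita_connection_def
  proof (intro conjI allI impI affine_connection_const_connection torsion_free_const_connection \<Gamma> sym)
    fix X Y Z :: "'a \<Rightarrow> 'a" and p
    assume sm: "smooth X" "smooth Y" "smooth Z"
    have EV: "((\<lambda>q. endo_apply (E q) (V q)) has_derivative
        (\<lambda>w. endo_apply (E p) (frechet_derivative V (at p) w) + endo_apply (E p) (\<Gamma> w (V p)))) (at p)"
      if "smooth V" for V
      using ea.FDERIV[OF E_deriv[of p] smooth_has_derivative[OF that, of p]] by simp
    show "cov_deriv_form (const_connection \<Gamma>) g Z X Y p = 0"
      unfolding cov_deriv_form_def g_def const_connection_def
      by (subst dir_deriv_eq[OF b.FDERIV[OF EV[OF sm(1)] EV[OF sm(2)]]])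
        (simp add: dir_deriv_def ea.add_right b.add_left b.add_right)
  qed
  moreover have "g 0 = b"
    by (intro ext) (simp add: g_def E0)
  ultimately show ?thesis
    by blast
qed

section \<open>Curvature and skew-adjoint maps\<close>

abbreviation skew_for :: "('a \<Rightarrow> 'a \<Rightarrow> real) \<Rightarrow> ('a \<Rightarrow> 'a) \<Rightarrow> bool" where
  "skew_for b T \<equiv> (\<forall>u v. b (T u) v + b u (T v) = 0)"

text \<open>
  The commutator of \<open>\<Gamma>\<^sub>w\<close> and \<open>\<Gamma>\<^sub>z\<close> is the curvature of the connection. Differentiating \<open>g(u, v)\<close> twice
  gives two terms in \<open>\<Gamma>\<^sub>w \<Gamma>\<^sub>z\<close> and two mixed ones; the latter are symmetric in \<open>w\<close> and \<open>z\<close>, so the symmetry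
  of second derivatives leaves the skew-adjointness of the commutator.
\<close>

lemma curvature_skew:
  fixes \<Gamma> :: "'a::euclidean_space \<Rightarrow> 'a \<Rightarrow> 'a"
  assumes g: "semi_riemannian_metric g" and lc: "levi_civita_connection (const_connection \<Gamma>) g"
  shows "skew_for (g p) (commutator (\<Gamma> w) (\<Gamma> z))"
proof (intro allI)
  fix u v
  note D = levi_civita_const_connection_derivative[OF g lc]
  have bil: "bilinear (g q)" for q
    using g by (simp add: semi_riemannian_metric_def nondegenerate_symmetric_form_def)
  have first: "frechet_derivative (\<lambda>q. g q u v) (at q) a = g q (\<Gamma> a u) v + g q u (\<Gamma> a v)" for q a
    by (simp add: frechet_derivative_at[OF D, symmetric])
  have second: "frechet_derivative (\<lambda>q. frechet_derivative (\<lambda>q. g q u v) (at q) a) (at p) c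
      = g p (\<Gamma> c (\<Gamma> a u)) v + g p (\<Gamma> a u) (\<Gamma> c v)
        + (g p (\<Gamma> c u) (\<Gamma> a v) + g p u (\<Gamma> c (\<Gamma> a v)))" for a c
    unfolding first by (simp add: frechet_derivative_at[OF has_derivative_add[OF D D], symmetric])
  have "smooth (\<lambda>q. g q u v)"
    using g by (simp add: semi_riemannian_metric_def)
  from symmetric_second_derivative[OF this, where v = z and p = p and w = w]
  show "g p (commutator (\<Gamma> w) (\<Gamma> z) u) v + g p u (commutator (\<Gamma> w) (\<Gamma> z) v) = 0"
    unfolding second
    by (simp add: commutator_def bilinear_lsub[OF bil] bilinear_rsub[OF bil])
qed

text \<open>
  The covariant derivative of a skew-adjoint tensor field is skew-adjoint, and that of a constant
  \<open>T\<close> is \<open>[\<Gamma>\<^sub>w, T]\<close>.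
\<close>

lemma commutator_skew:
  fixes \<Gamma> :: "'a::euclidean_space \<Rightarrow> 'a \<Rightarrow> 'a"
  assumes g: "semi_riemannian_metric g" and lc: "levi_civita_connection (const_connection \<Gamma>) g"
    and T: "\<And>p. skew_for (g p) T"
  shows "skew_for (g p) (commutator (\<Gamma> w) T)"
proof (intro allI)
  fix u v
  note D = levi_civita_const_connection_derivative[OF g lc]
  have bil: "bilinear (g q)" for q
    using g by (simp add: semi_riemannian_metric_def nondegenerate_symmetric_form_def)
  have "((\<lambda>q. g q (T u) v + g q u (T v)) has_derivative (\<lambda>w.
      g p (\<Gamma> w (T u)) v + g p (T u) (\<Gamma> w v) + (g p (\<Gamma> w u) (T v) + g p u (\<Gamma> w (T v))))) (at p)"
    by (intro has_derivative_add D)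
  moreover have "((\<lambda>q. g q (T u) v + g q u (T v)) has_derivative (\<lambda>w. 0)) (at p)"
    using T by simp
  ultimately have "g p (\<Gamma> w (T u)) v + g p (T u) (\<Gamma> w v)
      + (g p (\<Gamma> w u) (T v) + g p u (\<Gamma> w (T v))) = 0"
    by (rule has_derivative_unique[THEN fun_cong])
  moreover have "g p (T (\<Gamma> w u)) v + g p (\<Gamma> w u) (T v) = 0"
    "g p (T u) (\<Gamma> w v) + g p u (T (\<Gamma> w v)) = 0"
    using T by blast+
  ultimately show "g p (commutator (\<Gamma> w) T u) v + g p u (commutator (\<Gamma> w) T v) = 0"
    by (simp add: commutator_def bilinear_lsub[OF bil] bilinear_rsub[OF bil])
qed

section \<open>Skew-adjoint maps and commutators in the plane\<close>

lemma alternating_form_plane: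
  fixes b :: "real^2 \<Rightarrow> real^2 \<Rightarrow> real"
  assumes bil: "bilinear b" and alt: "\<And>u v. b u v = - b v u"
  shows "b u v = b (axis 1 1) (axis 2 1) * (u$1 * v$2 - u$2 * v$1)"
proof -
  have expand: "x = x$1 *\<^sub>R axis 1 1 + x$2 *\<^sub>R axis 2 1" for x :: "real^2"
    by (simp add: vec_eq_iff forall_2 axis_def)
  have diag: "b x x = 0" for x
    using alt[of x x] by simp
  have "b u v = b (u$1 *\<^sub>R axis 1 1 + u$2 *\<^sub>R axis 2 1) (v$1 *\<^sub>R axis 1 1 + v$2 *\<^sub>R axis 2 1)"
    by (simp flip: expand)
  also have "\<dots> = b (axis 1 1) (axis 2 1) * (u$1 * v$2 - u$2 * v$1)"
    using alt[of "axis 2 1" "axis 1 1"]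
    by (simp add: bilinear_ladd[OF bil] bilinear_radd[OF bil] bilinear_lmul[OF bil]
        bilinear_rmul[OF bil] diag algebra_simps)
  finally show ?thesis .
qed

text \<open>
  For a skew-adjoint \<open>T\<close> the form \<open>b(T u, v)\<close> is alternating, hence a multiple of the area form, and by
  nondegeneracy of \<open>b\<close> it determines \<open>T\<close>. So \<open>T\<close> is known up to a factor, and a nonzero \<open>T\<close> inherits
  the nondegeneracy of the area form.
\<close>

lemma skew_plane:
  fixes b :: "real^2 \<Rightarrow> real^2 \<Rightarrow> real"
  assumes b: "nondegenerate_symmetric_form b"
    and R: "linear R" "skew_for b R" "R \<noteq> (\<lambda>v. 0)"
  shows "(\<forall>u. R u = 0 \<longrightarrow> u = 0) \<and>
         (\<forall>T. linear T \<longrightarrow> skew_for b T \<longrightarrow> (\<exists>c. \<forall>v. T v = c *\<^sub>R R v))"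
proof (intro conjI allI impI)
  have bil: "bilinear b" and sym: "\<And>u v. b u v = b v u"
    and nondeg: "\<And>u. (\<And>v. b u v = 0) \<Longrightarrow> u = 0"
    using b by (auto simp: nondegenerate_symmetric_form_def)
  define m where "m T = b (T (axis 1 1)) (axis 2 1)" for T :: "real^2 \<Rightarrow> real^2"
  have form: "b (T u) v = m T * (u$1 * v$2 - u$2 * v$1)"
    if "linear T" "skew_for b T" for T u v
    unfolding m_def
  proof (rule alternating_form_plane)
    show "bilinear (\<lambda>u. b (T u))"
      using that(1) bil
      by (auto simp: bilinear_def intro: linear_compose[of T "\<lambda>u. b u _", unfolded o_def])
    show "b (T x) y = - b (T y) x" for x y
      using that(2)[rule_format, of x y] sym[of x "T y"] by (simp add: eq_neg_iff_add_eq_0)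
  qed
  have mR: "m R \<noteq> 0"
  proof
    assume "m R = 0"
    then have "b (R u) v = 0" for u v
      using form[OF R(1,2)] by simp
    then have "R = (\<lambda>v. 0)"
      using nondeg by blast
    with R(3) show False ..
  qed
  show "u = 0" if "R u = 0" for u
  proof -
    have "u$1 * v$2 - u$2 * v$1 = 0" for v :: "real^2"
      using form[OF R(1,2), of u v] that mR by (simp add: bilinear_lzero[OF bil])
    from this[of "axis 1 1"] this[of "axis 2 1"] show ?thesis
      by (simp add: vec_eq_iff forall_2 axis_def)
  qed
  show "\<exists>c. \<forall>v. T v = c *\<^sub>R R v" if T: "linear T" "skew_for b T" for T
  proof (intro exI allI)
    fix u
    have "b (T u - (m T / m R) *\<^sub>R R u) v = 0" for v
      using mR by (simp add: bilinear_lsub[OF bil] bilinear_lmul[OF bil] form[OF T] form[OF R(1,2)])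
    then show "T u = (m T / m R) *\<^sub>R R u"
      using nondeg[of "T u - (m T / m R) *\<^sub>R R u"] by simp
  qed
qed

lemma det_plane_eq_traces:
  fixes M :: "real^2^2"
  shows "2 * det M = (trace M)\<^sup>2 - trace (M ** M)"
  by (simp add: det_2 trace_def sum_2 matrix_matrix_mult_def power2_eq_square algebra_simps)

lemma matrix_mul_diff_rdistrib:
  fixes X Y :: "'a::ring_1^'n^'m"
  shows "(X - Y) ** Z = X ** Z - Y ** Z"
  by (simp add: matrix_matrix_mult_def vec_eq_iff sum_subtractf left_diff_distrib)

text \<open>
  A planar case of Jacobson's lemma on nilpotent commutators. The trace of \<open>R\<close> vanishes, so it suffices
  to show that the trace of \<open>R\<^sup>2\<close> does. Multiplying the hypothesis by \<open>R\<close> and taking traces yields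
  \<open>c tr(R\<^sup>2) = 0\<close>; if \<open>c = 0\<close>, then \<open>A\<close> commutes with \<open>R\<close>, and \<open>tr(R\<^sup>2) = tr([A, B] R) = 0\<close> by cyclicity.
\<close>

lemma det_commutator_eigen_eq_0:
  fixes A B :: "real^2^2"
  defines "R \<equiv> A ** B - B ** A"
  assumes eigen: "A ** R - R ** A = c *\<^sub>R R"
  shows "det R = 0"
proof -
  have "trace (A ** R ** R) = trace (R ** A ** R)"
    by (metis trace_mul_sym matrix_mul_assoc)
  then have "trace ((A ** R - R ** A) ** R) = 0"
    by (simp add: matrix_mul_diff_rdistrib trace_sub)
  then have c: "c * trace (R ** R) = 0"
    unfolding eigen by (simp add: scalar_matrix_assoc[symmetric] trace_def sum_distrib_left)
  have "trace (R ** R) = 0"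
  proof (cases "c = 0")
    case True
    then have AR: "A ** R = R ** A"
      using eigen by simp
    have "trace (R ** R) = trace (A ** B ** R) - trace (B ** A ** R)"
      by (simp add: R_def matrix_mul_diff_rdistrib trace_sub)
    also have "trace (B ** A ** R) = trace (A ** B ** R)"
      by (metis AR trace_mul_sym matrix_mul_assoc)
    finally show ?thesis by simp
  next
    case False
    with c show ?thesis by simp
  qed
  moreover have "trace R = 0"
    by (simp add: R_def trace_sub trace_mul_sym[of A B])
  ultimately show ?thesis
    using det_plane_eq_traces[of R] by simp
qed

section \<open>Metrizability of constant connections on the plane\<close>

lemma commuting_if_metric_plane:
  fixes \<Gamma> :: "real^2 \<Rightarrow> real^2 \<Rightarrow> real^2"
  assumes \<Gamma>: "bilinear \<Gamma>"
    and g: "semi_riemannian_metric g" and lc: "levi_civita_connection (const_connection \<Gamma>) g"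
  shows "commutator (\<Gamma> w) (\<Gamma> z) = (\<lambda>v. 0)"
proof (rule ccontr)
  define R where "R = commutator (\<Gamma> w) (\<Gamma> z)"
  define S where "S = commutator (\<Gamma> w) R"
  assume "commutator (\<Gamma> w) (\<Gamma> z) \<noteq> (\<lambda>v. 0)"
  then have R0: "R \<noteq> (\<lambda>v. 0)"
    by (simp add: R_def)
  have lin: "linear (\<Gamma> u)" for u
    using \<Gamma> by (simp add: bilinear_def)
  have lin_comm: "linear (commutator P Q)" if "linear P" "linear Q" for P Q :: "real^2 \<Rightarrow> real^2"
    using linear_compose_sub[OF linear_compose[OF that(2,1)] linear_compose[OF that]]
    by (simp add: commutator_def o_def)
  have linR: "linear R" and linS: "linear S"
    by (auto simp: R_def S_def intro!: lin_comm lin)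
  have R_skew: "skew_for (g p) R" for p
    unfolding R_def by (rule curvature_skew[OF g lc])
  have S_skew: "skew_for (g p) S" for p
    unfolding S_def by (rule commutator_skew[OF g lc R_skew])
  have "nondegenerate_symmetric_form (g 0)"
    using g by (simp add: semi_riemannian_metric_def)
  from skew_plane[OF this linR R_skew R0] linS S_skew
  obtain c where inj: "\<And>u. R u = 0 \<Longrightarrow> u = 0" and c: "\<And>v. S v = c *\<^sub>R R v"
    by blast
  have matrix_comm: "matrix (commutator P Q) = matrix P ** matrix Q - matrix Q ** matrix P"
    if "linear P" "linear Q" for P Q :: "real^2 \<Rightarrow> real^2"
    using matrix_compose[OF that] matrix_compose[OF that(2,1)]
    by (simp add: commutator_def matrix_def vec_eq_iff o_def)
  have "matrix S = c *\<^sub>R matrix R"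
    by (simp add: matrix_def vec_eq_iff c)
  moreover have mR: "matrix R = matrix (\<Gamma> w) ** matrix (\<Gamma> z) - matrix (\<Gamma> z) ** matrix (\<Gamma> w)"
    unfolding R_def by (rule matrix_comm[OF lin lin])
  moreover have mS: "matrix S = matrix (\<Gamma> w) ** matrix R - matrix R ** matrix (\<Gamma> w)"
    unfolding S_def by (rule matrix_comm[OF lin linR])
  ultimately have "det (matrix R) = 0"
    using det_commutator_eigen_eq_0[of "matrix (\<Gamma> w)" "matrix (\<Gamma> z)" c] by simp
  moreover have "inj R"
    using inj by (simp add: linear_injective_0[OF linR])
  ultimately show False
    using det_nz_iff_inj[OF linR] by simp
qed

theorem proposition4p9:
  fixes \<Gamma> :: "real^2 \<Rightarrow> real^2 \<Rightarrow> real^2" and S :: "(real^2 \<Rightarrow> real^2) set"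
  assumes "bilinear \<Gamma>"
    and "\<And>u v. \<Gamma> u v = \<Gamma> v u"
    and "S = range (\<lambda>v. \<Gamma> v)"
  shows "((\<exists>g. semi_riemannian_metric g \<and> levi_civita_connection (const_connection \<Gamma>) g)
            \<longleftrightarrow> (\<forall>X\<in>S. \<forall>Y\<in>S. commutator X Y = (\<lambda>v. 0)))
       \<and> ((\<forall>X\<in>S. \<forall>Y\<in>S. commutator X Y = (\<lambda>v. 0)) \<longrightarrow>
            (\<forall>g\<^sub>0. nondegenerate_symmetric_form g\<^sub>0 \<longrightarrow>
               (\<exists>g. semi_riemannian_metric g \<and> levi_civita_connection (const_connection \<Gamma>) g
                  \<and> g 0 = g\<^sub>0)))"
proof -
  have ex: "\<exists>g. semi_riemannian_metric g \<and> levi_civita_connection (const_connection \<Gamma>) g \<and> g 0 = b"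
    if "\<forall>X\<in>S. \<forall>Y\<in>S. commutator X Y = (\<lambda>v. 0)" "nondegenerate_symmetric_form b" for b
  proof (rule exists_metric_if_commuting[OF assms(1,2) _ that(2)])
    show "\<Gamma> u (\<Gamma> v w) = \<Gamma> v (\<Gamma> u w)" for u v w
      using that(1) by (simp add: assms(3) commutator_def fun_eq_iff)
  qed
  have "nondegenerate_symmetric_form ((\<bullet>) :: real^2 \<Rightarrow> real^2 \<Rightarrow> real)"
    unfolding nondegenerate_symmetric_form_def bilinear_conv_bounded_bilinear
    using bounded_bilinear_inner inner_commute inner_eq_zero_iff by blast
  moreover have "commutator X Y = (\<lambda>v. 0)"
    if "semi_riemannian_metric g" "levi_civita_connection (const_connection \<Gamma>) g" "X \<in> S" "Y \<in> S"
    for g X Y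
    using that commuting_if_metric_plane[OF assms(1)] assms(3) by blast
  ultimately show ?thesis
    using ex by blast
qed

end
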